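(* For every $n\ge 3$, $strc(C_n)=trc(C_n)$, where $C_n$ is the cycle of order $n$. Explicitly, $strc(C_n)$ equals $1,3,3,5,6,7,8,9,11,11$ for $n=3,4,5,6,7,8,9,10,11,12$ respectively, and $strc(C_n)=n$ for $n\ge 13$.
   Context: All graphs are finite and simple. A total-coloured path (vertices and edges coloured) is total-rainbow if its edges and internal vertices have pairwise distinct colours. $trc(G)$ is the minimum number of colours in a total-colouring of $G$ in which any two vertices are joined by a total-rainbow path; $strc(G)$ is the minimum number of colours in a total-colouring in which any two vertices $u,v$ are joined by a total-rainbow $u$–$v$ geodesic (a $u$–$v$ path of length $d(u,v)$). *)

theory Defs
  imports Main
begin

record 'a graph =
  verts :: "'a set"
  edges :: "'a set set"

definition fin_simple_graph :: "'a graph \<Rightarrow> bool" where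
  "fin_simple_graph G \<longleftrightarrow>
     finite (verts G) \<and> (\<forall>e \<in> edges G. e \<subseteq> verts G \<and> card e = 2)"

text \<open>A path is represented by the nonempty list of its (distinct) vertices.\<close>

fun path_edges :: "'a list \<Rightarrow> 'a set list" where
  "path_edges (x # y # xs) = {x, y} # path_edges (y # xs)"
| "path_edges _ = []"

definition internal_verts :: "'a list \<Rightarrow> 'a list" where
  "internal_verts p = butlast (tl p)"

definition is_path :: "'a graph \<Rightarrow> 'a \<Rightarrow> 'a list \<Rightarrow> 'a \<Rightarrow> bool" where
  "is_path G u p v \<longleftrightarrow>
     p \<noteq> [] \<and> hd p = u \<and> last p = v \<and> distinct p \<and>
     set p \<subseteq> verts G \<and> set (path_edges p) \<subseteq> edges G"

definition path_length :: "'a list \<Rightarrow> nat" where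
  "path_length p = length (path_edges p)"

definition graph_dist :: "'a graph \<Rightarrow> 'a \<Rightarrow> 'a \<Rightarrow> nat" where
  "graph_dist G u v = (LEAST k. \<exists>p. is_path G u p v \<and> path_length p = k)"

definition is_geodesic :: "'a graph \<Rightarrow> 'a \<Rightarrow> 'a list \<Rightarrow> 'a \<Rightarrow> bool" where
  "is_geodesic G u p v \<longleftrightarrow> is_path G u p v \<and> path_length p = graph_dist G u v"

text \<open>
  A total-colouring is an arbitrary function on the disjoint union of the vertices
  (\<open>Inl\<close>) and the edges (\<open>Inr\<close>); it need not be proper. Its values outside
  \<open>total_elems G\<close> are irrelevant.
\<close>

type_synonym 'a total_colouring = "'a + 'a set \<Rightarrow> nat"

definition total_elems :: "'a graph \<Rightarrow> ('a + 'a set) set" where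
  "total_elems G = verts G <+> edges G"

definition num_colours :: "'a graph \<Rightarrow> 'a total_colouring \<Rightarrow> nat" where
  "num_colours G c = card (c ` total_elems G)"

definition total_rainbow :: "'a total_colouring \<Rightarrow> 'a list \<Rightarrow> bool" where
  "total_rainbow c p \<longleftrightarrow> inj_on c (set (internal_verts p) <+> set (path_edges p))"

definition total_rainbow_connected :: "'a graph \<Rightarrow> 'a total_colouring \<Rightarrow> bool" where
  "total_rainbow_connected G c \<longleftrightarrow>
     (\<forall>u \<in> verts G. \<forall>v \<in> verts G. u \<noteq> v \<longrightarrow> (\<exists>p. is_path G u p v \<and> total_rainbow c p))"

definition strongly_total_rainbow_connected :: "'a graph \<Rightarrow> 'a total_colouring \<Rightarrow> bool" where
  "strongly_total_rainbow_connected G c \<longleftrightarrow>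
     (\<forall>u \<in> verts G. \<forall>v \<in> verts G. u \<noteq> v \<longrightarrow> (\<exists>p. is_geodesic G u p v \<and> total_rainbow c p))"

text \<open>
  Both parameters are meaningful for connected graphs only; otherwise no admissible
  colouring exists and the \<open>LEAST\<close> is unspecified.
\<close>

definition trc :: "'a graph \<Rightarrow> nat" where
  "trc G = (LEAST k. \<exists>c. total_rainbow_connected G c \<and> num_colours G c = k)"

definition strc :: "'a graph \<Rightarrow> nat" where
  "strc G = (LEAST k. \<exists>c. strongly_total_rainbow_connected G c \<and> num_colours G c = k)"

text \<open>Meaningful for \<open>n \<ge> 3\<close> only.\<close>

definition cycle_graph :: "nat \<Rightarrow> nat graph" where
  "cycle_graph n =
     \<lparr>verts = {..<n}, edges = {{i, (i + 1) mod n} | i. i < n}\<rparr>"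

lemma fin_simple_cycle_graph:
  assumes "n \<ge> 3"
  shows "fin_simple_graph (cycle_graph n)"
proof -
  have "i \<noteq> (i + 1) mod n" if "i < n" for i
    using assms that by (cases "i + 1 = n") auto
  then show ?thesis
    using assms by (auto simp: fin_simple_graph_def cycle_graph_def)
qed

end

(* Arrange the 2n vertices and edges cyclically. A path of length k between distinct vertices
   then uses 2k - 1 consecutive places, starting and ending with an edge. Colouring the places
   modulo n makes all geodesics rainbow, and explicit colourings do better for small n.
   Conversely, one of the two paths joining (nearly) antipodal vertices has length at least
   n div 2 and is rainbow, hence uses at least 2 (n div 2) - 1 colours. This bound is sharp for
   n = 3, 4, 5, 6, 8, 10, 12. For the other n, suppose that there are fewer than n colours. Then a
   rainbow path has length at most n / 2, so all paths of length K < n / 2 are rainbow, and double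
   counting the incidences between these n paths and a colour class of e edges and v vertices
   yields K e + (K - 1) v <= n; summing a suitable consequence of this over all colours bounds
   their number from below. *)

theory Submission
  imports Defs "HOL-Number_Theory.Cong"
begin

section \<open>Paths\<close>

lemma path_edges_conv_map:
  "path_edges p = map (\<lambda>j. {p ! j, p ! Suc j}) [0..<length p - 1]"
proof (induction p rule: path_edges.induct)
  case (1 x y xs)
  then show ?case
    by (simp add: upt_conv_Cons map_Suc_upt [symmetric] comp_def del: upt_Suc map_Suc_upt)
qed auto

lemma path_length_eq: "path_length p = length p - 1"
  by (simp add: path_length_def path_edges_conv_map)

lemma path_edges_snoc:
  "path_edges (xs @ [x, y]) = path_edges (xs @ [x]) @ [{x, y}]"
  by (induction xs rule: path_edges.induct) auto

lemma path_edges_rev: "path_edges (rev p) = rev (path_edges p)"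
  by (induction p rule: path_edges.induct) (auto simp: path_edges_snoc insert_commute)

lemma internal_verts_rev: "internal_verts (rev p) = rev (internal_verts p)"
  by (metis internal_verts_def butlast_rev butlast_tl rev_rev_ident)

lemma total_rainbow_rev [simp]: "total_rainbow c (rev p) = total_rainbow c p"
  by (simp add: total_rainbow_def path_edges_rev internal_verts_rev)

lemma is_path_rev: "is_path G u p v \<Longrightarrow> is_path G v (rev p) u"
  by (auto simp: is_path_def path_edges_rev hd_rev last_rev)

lemma path_length_rev [simp]: "path_length (rev p) = path_length p"
  by (simp add: path_length_eq)

lemma graph_dist_commute: "graph_dist G u v = graph_dist G v u"
proof -
  have "(\<exists>p. is_path G u p v \<and> path_length p = k) \<longleftrightarrow>
    (\<exists>p. is_path G v p u \<and> path_length p = k)" for k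
    using is_path_rev path_length_rev by metis
  then show ?thesis
    by (simp add: graph_dist_def)
qed

lemma is_geodesic_rev: "is_geodesic G u p v \<Longrightarrow> is_geodesic G v (rev p) u"
  by (metis is_geodesic_def is_path_rev path_length_rev graph_dist_commute)

section \<open>Paths in a cycle\<close>

text \<open>The start \<open>a\<close> is not reduced modulo \<open>n\<close>, so the complement of
  \<open>arc n a k\<close> can be written as \<open>arc n (a + k) (n - k)\<close>.\<close>

definition arc :: "nat \<Rightarrow> nat \<Rightarrow> nat \<Rightarrow> nat list" where
  "arc n a k = map (\<lambda>j. (a + j) mod n) [0..<Suc k]"

lemma length_arc [simp]: "length (arc n a k) = Suc k"
  by (simp add: arc_def)

lemma nth_arc: "j \<le> k \<Longrightarrow> arc n a k ! j = (a + j) mod n"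
  by (simp add: arc_def del: upt_Suc)

lemma arc_mod [simp]: "arc n (a mod n) k = arc n a k"
  by (simp add: arc_def mod_simps)

lemma hd_arc: "hd (arc n a k) = a mod n"
  by (metis add_0_right hd_conv_nth le0 length_0_conv length_arc nat.simps(3) nth_arc)

lemma last_arc: "last (arc n a k) = (a + k) mod n"
  by (simp add: arc_def)

lemma add_mod_cancel:
  "(a + i) mod n = (a + j) mod n \<Longrightarrow> i < n \<Longrightarrow> j < n \<Longrightarrow> i = (j::nat)"
  by (metis cong_add_lcancel_nat cong_def mod_less)

lemma path_edges_arc:
  "path_edges (arc n a k) = map (\<lambda>j. {(a + j) mod n, Suc (a + j) mod n}) [0..<k]"
  by (auto simp: path_edges_conv_map nth_arc intro!: map_cong)

lemma set_internal_verts_arc: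
  "set (internal_verts (arc n a k)) = (\<lambda>j. (a + j) mod n) ` {1..<k}"
proof -
  have "internal_verts (arc n a k) = map (\<lambda>j. (a + j) mod n) [1..<k]"
    by (intro nth_equalityI) (auto simp: internal_verts_def nth_butlast nth_tl nth_arc)
  then show ?thesis by simp
qed

lemma is_path_arc:
  assumes "n > 0" "k < n"
  shows "is_path (cycle_graph n) (a mod n) (arc n a k) ((a + k) mod n)"
proof -
  have "distinct (arc n a k)"
    using assms by (auto simp: arc_def distinct_map inj_on_def dest: add_mod_cancel
      simp del: upt_Suc)
  moreover have "set (path_edges (arc n a k)) \<subseteq> edges (cycle_graph n)"
    using assms by (force simp: path_edges_arc cycle_graph_def mod_simps)
  moreover have "set (arc n a k) \<subseteq> verts (cycle_graph n)"
    using assms by (auto simp: arc_def cycle_graph_def)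
  ultimately show ?thesis
    using length_arc [of n a k] by (auto simp: is_path_def hd_arc last_arc simp del: length_arc)
qed

text \<open>Each step goes up or down by one modulo \<open>n\<close>. As no vertex repeats, the path
  cannot turn back, so its first step fixes the direction; a descending path is an arc read
  backwards.\<close>

lemma path_in_cycle_is_arc:
  assumes "is_path (cycle_graph n) u p v" "length p = Suc k"
  shows "p = arc n u k \<or> rev p = arc n v k"
proof -
  define up where "up j \<longleftrightarrow> p ! Suc j = Suc (p ! j) mod n" for j
  define dn where "dn j \<longleftrightarrow> p ! j = Suc (p ! Suc j) mod n" for j
  have dist: "distinct p" and hd: "p ! 0 = u" and lst: "p ! k = v"
    using assms by (auto simp: is_path_def hd_conv_nth last_conv_nth)
  have lt: "p ! j < n" if "j \<le> k" for j
  proof -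
    have "p ! j \<in> set p" using assms(2) that by simp
    then show ?thesis using assms(1) by (auto simp: is_path_def cycle_graph_def)
  qed
  have step: "up j \<or> dn j" if "j < k" for j
  proof -
    have "{p ! j, p ! Suc j} \<in> set (path_edges p)"
      using that assms(2) by (auto simp: path_edges_conv_map)
    then have "{p ! j, p ! Suc j} \<in> edges (cycle_graph n)"
      using assms(1) by (auto simp: is_path_def)
    then show ?thesis
      by (auto simp: cycle_graph_def doubleton_eq_iff up_def dn_def)
  qed
  have ne: "p ! j \<noteq> p ! Suc (Suc j)" if "Suc j < k" for j
    using dist that assms(2) by (simp add: nth_eq_iff_index_eq)
  \<comment> \<open>If step \<open>Suc j\<close> went down, \<open>p ! j\<close> and
    \<open>p ! Suc (Suc j)\<close> would have the same successor, hence be equal.\<close>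
  have up_Suc: "up (Suc j)" if "up j" "Suc j < k" for j
  proof (rule ccontr)
    assume "\<not> up (Suc j)"
    then have "Suc (p ! j) mod n = Suc (p ! Suc (Suc j)) mod n"
      using step [of "Suc j"] that by (auto simp: up_def dn_def)
    then have "p ! j = p ! Suc (Suc j)"
      using add_mod_cancel [of 1 "p ! j" n "p ! Suc (Suc j)"] lt that by simp
    with ne that show False by simp
  qed
  have dn_Suc: "dn (Suc j)" if "dn j" "Suc j < k" for j
    using step [of "Suc j"] ne [of j] that unfolding up_def dn_def by metis
  show ?thesis
  proof (cases "k = 0 \<or> up 0")
    case True
    have ups: "up j" if "j < k" for j
      using that True by (induction j) (auto intro: up_Suc)
    have "p ! j = (u + j) mod n" if "j \<le> k" for j
      using that
    proof (induction j)
      case 0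
      then show ?case using hd lt [of 0] by simp
    next
      case (Suc j)
      then show ?case using ups [of j] by (simp add: up_def mod_simps)
    qed
    then have "p = arc n u k"
      using assms(2) by (intro nth_equalityI) (auto simp: nth_arc)
    then show ?thesis ..
  next
    case False
    then have "dn 0" using step by auto
    have dns: "dn j" if "j < k" for j
      using that \<open>dn 0\<close> by (induction j) (auto intro: dn_Suc)
    have "p ! (k - j) = (v + j) mod n" if "j \<le> k" for j
      using that
    proof (induction j)
      case 0
      then show ?case using lst lt [of k] by simp
    next
      case (Suc j)
      then have "Suc (k - Suc j) = k - j" by simp
      with Suc show ?case using dns [of "k - Suc j"] by (simp add: dn_def mod_simps)
    qed
    then have "rev p = arc n v k"
      using assms(2) by (intro nth_equalityI) (auto simp: nth_arc rev_nth)
    then show ?thesis ..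
  qed
qed

lemma path_in_cycle_length_less:
  assumes "is_path (cycle_graph n) u p v" "length p = Suc k"
  shows "k < n"
proof -
  have "card (set p) \<le> card {..<n}"
    using assms(1) by (intro card_mono) (auto simp: is_path_def cycle_graph_def)
  then show ?thesis
    using assms by (simp add: is_path_def distinct_card)
qed

text \<open>The end points determine the length modulo \<open>n\<close>, and a path is shorter than
  \<open>n\<close>; thus each direction admits exactly one length.\<close>

lemma path_in_cycle_cases:
  assumes "is_path (cycle_graph n) (a mod n) p ((a + k) mod n)" "0 < k" "k < n"
  obtains "p = arc n a k" | "rev p = arc n (a + k) (n - k)"
proof -
  obtain l where l: "length p = Suc l"
    using assms(1) by (cases p) (auto simp: is_path_def)
  have "l < n"
    using path_in_cycle_length_less [OF assms(1) l] .
  have ends: "hd p = a mod n" "last p = (a + k) mod n" "p \<noteq> []"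
    using assms(1) by (auto simp: is_path_def)
  from path_in_cycle_is_arc [OF assms(1) l] show ?thesis
  proof
    assume p: "p = arc n (a mod n) l"
    then have "(a + l) mod n = (a + k) mod n"
      using ends by (simp add: last_arc)
    then have "l = k"
      using \<open>l < n\<close> \<open>k < n\<close> by (rule add_mod_cancel)
    with p that show ?thesis by simp
  next
    assume p: "rev p = arc n ((a + k) mod n) l"
    then have "(a + k + l) mod n = a mod n"
      using ends by (metis arc_mod last_arc last_rev)
    then have "(a + k + l) mod n = (a + k + (n - k)) mod n"
      using assms by simp
    then have "l = n - k"
      by (rule add_mod_cancel) (use assms \<open>l < n\<close> in auto)
    with p that show ?thesis by simp
  qed
qed

text \<open>The only rival has length \<open>n - k\<close>, which is at least \<open>k\<close>. For
  \<open>2 * k = n\<close> both arcs are geodesics.\<close>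

lemma is_geodesic_arc:
  assumes "0 < k" "2 * k \<le> n"
  shows "is_geodesic (cycle_graph n) (a mod n) (arc n a k) ((a + k) mod n)"
proof -
  have path: "is_path (cycle_graph n) (a mod n) (arc n a k) ((a + k) mod n)"
    using assms by (intro is_path_arc) auto
  have "graph_dist (cycle_graph n) (a mod n) ((a + k) mod n) = k"
    unfolding graph_dist_def
  proof (rule Least_equality)
    show "\<exists>p. is_path (cycle_graph n) (a mod n) p ((a + k) mod n) \<and> path_length p = k"
      using path by (intro exI [of _ "arc n a k"]) (simp add: path_length_eq)
  next
    fix l
    assume "\<exists>p. is_path (cycle_graph n) (a mod n) p ((a + k) mod n) \<and> path_length p = l"
    then obtain p where p: "is_path (cycle_graph n) (a mod n) p ((a + k) mod n)"
      and l: "l = length p - 1"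
      by (auto simp: path_length_eq)
    have "0 < k" "k < n" using assms by auto
    from p this show "k \<le> l"
    proof (cases rule: path_in_cycle_cases)
      case 1
      then show ?thesis using l by simp
    next
      case 2
      then have "length p = Suc (n - k)" by (metis length_arc length_rev)
      then show ?thesis using l assms by simp
    qed
  qed
  with path show ?thesis
    by (simp add: is_geodesic_def path_length_eq)
qed

section \<open>The cyclic order of vertices and edges\<close>

text \<open>Going once around the cycle, the vertex \<open>i\<close> sits at position \<open>2 * i\<close> and the edge from
  \<open>i\<close> to \<open>i + 1\<close> at position \<open>2 * i + 1\<close>; positions count modulo \<open>2 * n\<close>.\<close>

definition pos :: "nat \<Rightarrow> nat \<Rightarrow> nat + nat set" where
  "pos n p = (if even p then Inl (p div 2 mod n)
     else Inr {p div 2 mod n, Suc (p div 2) mod n})"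

lemma pos_even [simp]: "pos n (2 * i) = Inl (i mod n)"
  by (simp add: pos_def)

lemma pos_odd [simp]: "pos n (Suc (2 * i)) = Inr {i mod n, Suc i mod n}"
  by (simp add: pos_def)

text \<open>Two edges could coincide otherwise only with their ends swapped, forcing 2 to be 0
  modulo \<open>n\<close>; this does happen for \<open>n = 2\<close>.\<close>

lemma cycle_edge_eq_iff:
  assumes "n \<ge> 3"
  shows "{i mod n, Suc i mod n} = {j mod n, Suc j mod n} \<longleftrightarrow> i mod n = j mod n"
proof
  assume eq: "{i mod n, Suc i mod n} = {j mod n, Suc j mod n}"
  show "i mod n = j mod n"
  proof (rule ccontr)
    assume "i mod n \<noteq> j mod n"
    with eq have "i mod n = Suc j mod n" "Suc i mod n = j mod n"
      by (auto simp: doubleton_eq_iff)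
    then have "(i + 2) mod n = (i + 0) mod n"
      by (metis add_2_eq_Suc' add_0_right mod_Suc_eq)
    then have "2 = (0::nat)"
      by (rule add_mod_cancel) (use assms in auto)
    then show False by simp
  qed
next
  assume "i mod n = j mod n"
  then show "{i mod n, Suc i mod n} = {j mod n, Suc j mod n}"
    by (metis mod_Suc_eq)
qed

lemma pos_eq_iff:
  assumes "n \<ge> 3"
  shows "pos n x = pos n y \<longleftrightarrow> x mod (2 * n) = y mod (2 * n)"
proof -
  have *: "2 * i mod (2 * n) = 2 * (i mod n)" "Suc (2 * i) mod (2 * n) = Suc (2 * (i mod n))" for i
    using assms by (auto simp: mod_mult2_eq)
  have parity: "Suc (2 * i) \<noteq> 2 * j" "2 * j \<noteq> Suc (2 * i)" for i j :: nat
    by presburger+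
  have odd_iff: "pos n (Suc (2 * i)) = pos n (Suc (2 * j)) \<longleftrightarrow> i mod n = j mod n" for i j
    by (simp only: pos_odd sum.inject cycle_edge_eq_iff [OF assms])
  show ?thesis
    by (cases x rule: parity_cases; cases y rule: parity_cases)
      (auto elim!: evenE oddE simp: * parity odd_iff simp del: pos_odd, simp_all)
qed

lemma inj_on_pos:
  assumes "n \<ge> 3" "l \<le> 2 * n"
  shows "inj_on (pos n) {b..<b + l}"
proof (rule inj_onI)
  fix x y assume xy: "x \<in> {b..<b + l}" "y \<in> {b..<b + l}" "pos n x = pos n y"
  then have "(b + (x - b)) mod (2 * n) = (b + (y - b)) mod (2 * n)"
    using assms(1) by (simp add: pos_eq_iff)
  then have "x - b = y - b"
    by (rule add_mod_cancel) (use xy assms in auto)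
  with xy show "x = y" by auto
qed

lemma total_elems_cycle_graph:
  assumes "n > 0"
  shows "total_elems (cycle_graph n) = pos n ` {..<2 * n}"
proof (intro equalityI subsetI)
  fix x assume "x \<in> total_elems (cycle_graph n)"
  then consider i where "i < n" "x = Inl i" | i where "i < n" "x = Inr {i, Suc i mod n}"
    by (auto simp: total_elems_def cycle_graph_def)
  then show "x \<in> pos n ` {..<2 * n}"
  proof cases
    case 1
    then show ?thesis by (intro image_eqI [of _ _ "2 * i"]) auto
  next
    case 2
    then show ?thesis by (intro image_eqI [of _ _ "Suc (2 * i)"]) auto
  qed
next
  fix x assume "x \<in> pos n ` {..<2 * n}"
  then show "x \<in> total_elems (cycle_graph n)"
    using assms by (auto simp: total_elems_def cycle_graph_def pos_def)
qed

lemma num_colours_cycle_graph: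
  "n > 0 \<Longrightarrow> num_colours (cycle_graph n) c = card ((c \<circ> pos n) ` {..<2 * n})"
  by (simp add: num_colours_def total_elems_cycle_graph image_comp)

text \<open>The end vertices \<open>2 * a\<close> and \<open>2 * a + 2 * k\<close> are left out, as
  they are not internal; for positive \<open>k\<close> this leaves \<open>2 * k - 1\<close>
  positions. The form with \<open>distinct\<close> is executable.\<close>

definition rainbow_arc :: "(nat \<Rightarrow> nat) \<Rightarrow> nat \<Rightarrow> nat \<Rightarrow> bool" where
  "rainbow_arc f a k \<longleftrightarrow> distinct (map f [2 * a + 1..<2 * a + 2 * k])"

lemma rainbow_arc_iff: "rainbow_arc f a k \<longleftrightarrow> inj_on f {2 * a + 1..<2 * a + 2 * k}"
  by (simp add: rainbow_arc_def distinct_map)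

lemma rainbow_arc_mono: "rainbow_arc f a l \<Longrightarrow> k \<le> l \<Longrightarrow> rainbow_arc f a k"
  unfolding rainbow_arc_iff by (erule inj_on_subset) auto

lemma pos_image_arc:
  "pos n ` {2 * a + 1..<2 * a + 2 * k} =
    set (internal_verts (arc n a k)) <+> set (path_edges (arc n a k))"
proof (intro equalityI subsetI)
  fix x assume "x \<in> pos n ` {2 * a + 1..<2 * a + 2 * k}"
  then obtain p where p: "x = pos n p" "2 * a + 1 \<le> p" "p < 2 * a + 2 * k"
    by auto
  show "x \<in> set (internal_verts (arc n a k)) <+> set (path_edges (arc n a k))"
  proof (cases "even p")
    case True
    then obtain i where "p = 2 * i" by (elim evenE)
    with p show ?thesis
      by (auto simp: set_internal_verts_arc intro!: InlI image_eqI [of _ _ "i - a"])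
  next
    case False
    then obtain i where "p = Suc (2 * i)" by (elim oddE) auto
    with p show ?thesis
      by (auto simp: path_edges_arc intro!: InrI image_eqI [of _ _ "i - a"])
  qed
next
  fix x assume "x \<in> set (internal_verts (arc n a k)) <+> set (path_edges (arc n a k))"
  then consider j where "x = pos n (2 * (a + j))" "1 \<le> j" "j < k"
    | j where "x = pos n (Suc (2 * (a + j)))" "j < k"
    unfolding pos_even pos_odd by (auto simp: set_internal_verts_arc path_edges_arc)
  then show "x \<in> pos n ` {2 * a + 1..<2 * a + 2 * k}"
    by cases (auto intro!: imageI simp del: pos_even pos_odd)
qed

text \<open>The window is shorter than one period \<open>2 * n\<close>, so \<open>pos n\<close> is
  injective on it and repeated colours come from \<open>c\<close> alone.\<close>

lemma total_rainbow_arc_iff: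
  assumes "n \<ge> 3" "0 < k" "k \<le> n"
  shows "total_rainbow c (arc n a k) \<longleftrightarrow> rainbow_arc (c \<circ> pos n) a k"
proof -
  have "inj_on (pos n) {2 * a + 1..<2 * a + 1 + (2 * k - 1)}"
    using assms by (intro inj_on_pos) auto
  moreover have "2 * a + 1 + (2 * k - 1) = 2 * a + 2 * k"
    using assms by simp
  ultimately have "inj_on (pos n) {2 * a + 1..<2 * a + 2 * k}"
    by simp
  then show ?thesis
    unfolding total_rainbow_def rainbow_arc_iff pos_image_arc [symmetric]
    by (rule comp_inj_on_iff)
qed

section \<open>Translating connectedness into conditions on windows of positions\<close>

lemma rainbow_arcs_if_total_rainbow_connected:
  assumes "n \<ge> 3" "total_rainbow_connected (cycle_graph n) c" "0 < k" "k < n"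
  shows "rainbow_arc (c \<circ> pos n) a k \<or> rainbow_arc (c \<circ> pos n) (a + k) (n - k)"
proof -
  have "(a + 0) mod n \<noteq> (a + k) mod n"
    using add_mod_cancel [of a 0 n k] assms by linarith
  then obtain p where p: "is_path (cycle_graph n) (a mod n) p ((a + k) mod n)"
    and rb: "total_rainbow c p"
    using assms unfolding total_rainbow_connected_def by (force simp: cycle_graph_def)
  from p assms(3,4) show ?thesis
  proof (cases rule: path_in_cycle_cases)
    case 1
    with rb assms show ?thesis by (simp add: total_rainbow_arc_iff)
  next
    case 2
    then have "total_rainbow c (arc n (a + k) (n - k))"
      using rb by (metis total_rainbow_rev)
    with assms show ?thesis by (simp add: total_rainbow_arc_iff)
  qed
qed

text \<open>The disjunction reflects that only antipodal vertices have two geodesics to choose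
  from.\<close>

lemma strongly_total_rainbow_connected_if_rainbow_arcs:
  assumes n: "n \<ge> 3"
    and arcs: "\<And>a k. a < n \<Longrightarrow> 0 < k \<Longrightarrow> 2 * k \<le> n \<Longrightarrow>
      rainbow_arc (c \<circ> pos n) a k \<or> 2 * k = n \<and> rainbow_arc (c \<circ> pos n) (a + k) k"
  shows "strongly_total_rainbow_connected (cycle_graph n) c"
proof -
  have *: "\<exists>p. is_geodesic (cycle_graph n) a p ((a + k) mod n) \<and> total_rainbow c p"
    if "a < n" "0 < k" "2 * k \<le> n" for a k
    using arcs [OF that]
  proof
    assume "rainbow_arc (c \<circ> pos n) a k"
    then show ?thesis
      using is_geodesic_arc [OF that(2,3), of a] that n
      by (intro exI [of _ "arc n a k"]) (auto simp: total_rainbow_arc_iff)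
  next
    assume "2 * k = n \<and> rainbow_arc (c \<circ> pos n) (a + k) k"
    moreover from this have "(a + k + k) mod n = a"
      using that by (metis add.assoc mod_add_self2 mod_less mult_2)
    ultimately show ?thesis
      using is_geodesic_rev [OF is_geodesic_arc [OF that(2,3), of "a + k"]] that n
      by (intro exI [of _ "rev (arc n (a + k) k)"]) (auto simp: total_rainbow_arc_iff)
  qed
  show ?thesis
    unfolding strongly_total_rainbow_connected_def
  proof (intro ballI impI)
    fix u v
    assume "u \<in> verts (cycle_graph n)" "v \<in> verts (cycle_graph n)" and ne: "u \<noteq> v"
    then have lt: "u < n" "v < n" by (auto simp: cycle_graph_def)
    \<comment> \<open>The length of the ascending path from \<open>u\<close> to \<open>v\<close>;
      adding \<open>n\<close> avoids truncated subtraction. If it exceeds half of \<open>n\<close>,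
      the ascending path from \<open>v\<close> to \<open>u\<close> is used in reverse.\<close>
    define k where "k = (v + n - u) mod n"
    have "(u + k) mod n = v"
      using lt by (simp add: k_def mod_simps)
    have "k < n" using n by (simp add: k_def)
    have "k \<noteq> 0" using ne lt \<open>(u + k) mod n = v\<close> by (metis add_0_right mod_less)
    have "(v + (n - k)) mod n = (u + k + (n - k)) mod n"
      by (simp only: \<open>(u + k) mod n = v\<close> [symmetric] mod_add_left_eq)
    then have "(v + (n - k)) mod n = u"
      using \<open>k < n\<close> lt by simp
    show "\<exists>p. is_geodesic (cycle_graph n) u p v \<and> total_rainbow c p"
    proof (cases "2 * k \<le> n")
      case True
      with * [of u k] lt \<open>k \<noteq> 0\<close> \<open>(u + k) mod n = v\<close> show ?thesis by auto
    next
      case False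
      then have "2 * (n - k) \<le> n" by simp
      with * [of v "n - k"] lt \<open>k < n\<close>
      obtain p where "is_geodesic (cycle_graph n) v p u" "total_rainbow c p"
        unfolding \<open>(v + (n - k)) mod n = u\<close> by auto
      then show ?thesis
        by (metis is_geodesic_rev total_rainbow_rev)
    qed
  qed
qed

section \<open>Colourings given by a sequence of 2n colours\<close>

lemma ex_colouring_of_positions:
  assumes "n \<ge> 3"
  obtains c where "c \<circ> pos n = (\<lambda>p. f (p mod (2 * n)))"
proof
  define c where "c = (\<lambda>x. f (inv_into {..<2 * n} (pos n) x))"
  have inj: "inj_on (pos n) {..<2 * n}"
    using inj_on_pos [of n "2 * n" 0] assms by (simp add: atLeast0LessThan)
  show "c \<circ> pos n = (\<lambda>p. f (p mod (2 * n)))"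
  proof
    fix p
    have "pos n p = pos n (p mod (2 * n))" using assms by (simp add: pos_eq_iff)
    moreover have "p mod (2 * n) \<in> {..<2 * n}" using assms by simp
    ultimately show "(c \<circ> pos n) p = f (p mod (2 * n))"
      using inj by (simp add: c_def inv_into_f_f)
  qed
qed

text \<open>\<open>(n - 1) div 2\<close> is the largest length below n/2, and shorter arcs are
  subwindows of these. Only the antipodal pairs for even \<open>n\<close> remain.\<close>

lemma strong_colouring_of_positions:
  assumes "n \<ge> 3"
    and "\<And>a. a < n \<Longrightarrow> rainbow_arc (\<lambda>p. f (p mod (2 * n))) a ((n - 1) div 2)"
    and "\<And>a. a < n \<Longrightarrow> even n \<Longrightarrow> rainbow_arc (\<lambda>p. f (p mod (2 * n))) a (n div 2) \<or>
      rainbow_arc (\<lambda>p. f (p mod (2 * n))) (a + n div 2) (n div 2)"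
  shows "\<exists>c. strongly_total_rainbow_connected (cycle_graph n) c \<and>
    num_colours (cycle_graph n) c = card (f ` {..<2 * n})"
proof -
  obtain c where c: "c \<circ> pos n = (\<lambda>p. f (p mod (2 * n)))"
    using ex_colouring_of_positions assms(1) .
  have "strongly_total_rainbow_connected (cycle_graph n) c"
  proof (rule strongly_total_rainbow_connected_if_rainbow_arcs [OF assms(1)], unfold c)
    fix a k :: nat
    assume "a < n" "0 < k" "2 * k \<le> n"
    then consider "2 * k = n" | "k \<le> (n - 1) div 2" by linarith
    then show "rainbow_arc (\<lambda>p. f (p mod (2 * n))) a k \<or>
        2 * k = n \<and> rainbow_arc (\<lambda>p. f (p mod (2 * n))) (a + k) k"
    proof cases
      case 1
      then have "even n" "n div 2 = k" by auto
      with assms(3) [OF \<open>a < n\<close>] 1 show ?thesis by simp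
    next
      case 2
      with assms(2) [OF \<open>a < n\<close>] show ?thesis by (blast intro: rainbow_arc_mono)
    qed
  qed
  moreover have "(\<lambda>p. f (p mod (2 * n))) ` {..<2 * n} = f ` {..<2 * n}"
    by (intro image_cong) auto
  ultimately show ?thesis
    using num_colours_cycle_graph [of n c, unfolded c] assms(1) by auto
qed

section \<open>Upper bounds\<close>

text \<open>A geodesic occupies fewer than \<open>n\<close> consecutive positions, so their residues
  modulo \<open>n\<close> differ; as \<open>n\<close> divides \<open>2 * n\<close>, this colouring
  is well defined around the cycle.\<close>

lemma strong_colouring_trivial:
  assumes "n \<ge> 3"
  shows "\<exists>c. strongly_total_rainbow_connected (cycle_graph n) c \<and> num_colours (cycle_graph n) c = n"
proof -
  define f where "f = (\<lambda>p. p mod n)"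
  have rb: "rainbow_arc (\<lambda>p. f (p mod (2 * n))) a k" if "2 * k \<le> n" for a k
    unfolding rainbow_arc_iff
  proof (rule inj_onI)
    fix x y
    assume xy: "x \<in> {2 * a + 1..<2 * a + 2 * k}" "y \<in> {2 * a + 1..<2 * a + 2 * k}"
      "f (x mod (2 * n)) = f (y mod (2 * n))"
    then have "(2 * a + (x - 2 * a)) mod n = (2 * a + (y - 2 * a)) mod n"
      by (simp add: f_def mod_mod_cancel)
    then have "x - 2 * a = y - 2 * a"
      by (rule add_mod_cancel) (use xy that in auto)
    with xy show "x = y" by auto
  qed
  have "f ` {..<2 * n} = {..<n}"
  proof (intro equalityI subsetI)
    fix x assume "x \<in> {..<n}"
    then show "x \<in> f ` {..<2 * n}"
      by (intro image_eqI [of _ _ x]) (auto simp: f_def)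
  qed (use assms in \<open>auto simp: f_def\<close>)
  then show ?thesis
    using strong_colouring_of_positions [OF assms, of f] rb by simp
qed

text \<open>The colours alternate between vertices and edges, starting at vertex 0. All quantifiers
  range over finite lists, so \<open>code_simp\<close> can decide the predicate.\<close>

definition strong_colour_list :: "nat \<Rightarrow> nat list \<Rightarrow> bool" where
  "strong_colour_list n xs \<longleftrightarrow> length xs = 2 * n \<and>
    (\<forall>a \<in> set [0..<n]. rainbow_arc (\<lambda>p. xs ! (p mod (2 * n))) a ((n - 1) div 2) \<and>
      (even n \<longrightarrow> rainbow_arc (\<lambda>p. xs ! (p mod (2 * n))) a (n div 2) \<or>
        rainbow_arc (\<lambda>p. xs ! (p mod (2 * n))) (a + n div 2) (n div 2)))"

lemma strong_colouring_of_list: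
  assumes "n \<ge> 3" "strong_colour_list n xs" "length (remdups xs) = m"
  shows "\<exists>c. strongly_total_rainbow_connected (cycle_graph n) c \<and> num_colours (cycle_graph n) c = m"
proof -
  have "(!) xs ` {..<2 * n} = set xs"
    using assms(2) by (auto simp: strong_colour_list_def set_conv_nth)
  then show ?thesis
    using strong_colouring_of_positions [OF assms(1), of "(!) xs"] assms
    by (simp add: strong_colour_list_def length_remdups_card_conv)
qed

section \<open>Lower bounds\<close>

lemma arc_length_le_num_colours:
  assumes "n \<ge> 3" "rainbow_arc (c \<circ> pos n) a k"
  shows "2 * k - 1 \<le> num_colours (cycle_graph n) c"
proof -
  let ?f = "c \<circ> pos n"
  have "?f ` {2 * a + 1..<2 * a + 2 * k} \<subseteq> ?f ` {..<2 * n}"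
  proof (rule image_subsetI)
    fix x
    \<comment> \<open>The window may extend beyond the first period, since \<open>a\<close> is
      arbitrary.\<close>
    have "pos n x = pos n (x mod (2 * n))"
      using assms(1) by (simp add: pos_eq_iff)
    then show "?f x \<in> ?f ` {..<2 * n}"
      using assms(1) by (intro image_eqI [of _ _ "x mod (2 * n)"]) auto
  qed
  then have "card (?f ` {2 * a + 1..<2 * a + 2 * k}) \<le> card (?f ` {..<2 * n})"
    by (intro card_mono) auto
  then show ?thesis
    using card_image [of ?f "{2 * a + 1..<2 * a + 2 * k}"] assms
    by (simp add: rainbow_arc_iff num_colours_cycle_graph del: o_apply)
qed

lemma num_colours_ge:
  assumes "n \<ge> 3" "total_rainbow_connected (cycle_graph n) c"
  shows "2 * (n div 2) - 1 \<le> num_colours (cycle_graph n) c"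
proof -
  \<comment> \<open>Splitting the cycle as evenly as possible makes the shorter of the two arcs as
    long as possible.\<close>
  have "rainbow_arc (c \<circ> pos n) 0 (n div 2) \<or>
      rainbow_arc (c \<circ> pos n) (0 + n div 2) (n - n div 2)"
    using assms by (intro rainbow_arcs_if_total_rainbow_connected) auto
  then obtain b where "rainbow_arc (c \<circ> pos n) b (n div 2)"
    using rainbow_arc_mono [of _ _ "n - n div 2" "n div 2"] by fastforce
  with assms(1) show ?thesis by (rule arc_length_le_num_colours)
qed

section \<open>Double counting for colourings with fewer than n colours\<close>

lemma sum_shift_periodic:
  fixes F :: "nat \<Rightarrow> 'a :: ab_group_add"
  assumes "\<And>j. F (j + n) = F j"
  shows "(\<Sum>a<n. F (a + j)) = (\<Sum>a<n. F a)"
proof (induction j)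
  case (Suc j)
  \<comment> \<open>Both sides sum \<open>F\<close> from \<open>j\<close> to \<open>n + j\<close>.
    Cancelling \<open>F j = F (j + n)\<close> needs a group, hence the integer indicator in the next
    lemma.\<close>
  have "F j + (\<Sum>a<n. F (Suc a + j)) = (\<Sum>a<n. F (a + j)) + F (n + j)"
    using sum.lessThan_Suc_shift [of "\<lambda>a. F (a + j)" n] sum.lessThan_Suc [of "\<lambda>a. F (a + j)" n]
    by simp
  with Suc show ?case
    using assms [of j] by (simp add: add.commute)
qed simp

text \<open>Every one of the \<open>n\<close> rainbow arcs of length \<open>Suc l\<close> meets a colour class at most once,
  whereas an edge lies on \<open>Suc l\<close> of these arcs and a vertex is internal to \<open>l\<close> of them.\<close>

lemma colour_class_bound:
  assumes periodic: "\<And>x. f (x + 2 * n) = f x"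
    and arcs: "\<And>a. a < n \<Longrightarrow> rainbow_arc f a (Suc l)"
  shows "Suc l * card {j. j < n \<and> f (Suc (2 * j)) = i} + l * card {j. j < n \<and> f (2 * j) = i} \<le> n"
proof -
  define F :: "nat \<Rightarrow> int" where "F x = (if f x = i then 1 else 0)" for x
  have shift: "(\<Sum>a<n. F (2 * (a + j) + d)) = (\<Sum>a<n. F (2 * a + d))" for j d
  proof (rule sum_shift_periodic)
    show "F (2 * (j + n) + d) = F (2 * j + d)" for j
      using periodic [of "2 * j + d"] by (simp add: F_def algebra_simps)
  qed
  \<comment> \<open>The first edge, then each internal vertex paired with the edge after it; the
    \<open>+ 0\<close> matches the form of \<open>shift\<close>.\<close>
  have window: "sum F {2 * a + 1..<2 * a + 2 * Suc l} =
    F (2 * a + 1) + (\<Sum>j<l. F (2 * (a + Suc j) + 0) + F (2 * (a + Suc j) + 1))" for a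
    by (induction l) (simp_all add: algebra_simps)
  have le1: "sum F {2 * a + 1..<2 * a + 2 * Suc l} \<le> 1" if "a < n" for a
  proof -
    let ?W = "{2 * a + 1..<2 * a + 2 * Suc l}"
    have "sum F ?W = int (card {x \<in> ?W. f x = i})"
      by (simp add: F_def sum.If_cases Int_def del: mult_Suc_right)
    also have "\<dots> \<le> 1"
      using arcs [OF that] by (auto simp: rainbow_arc_iff inj_on_def card_le_Suc0_iff_eq)
    finally show ?thesis .
  qed
  have count: "(\<Sum>a<n. F (2 * a + d)) = int (card {j. j < n \<and> f (2 * j + d) = i})" for d
    by (simp add: F_def sum.If_cases Int_def)
  have "(\<Sum>a<n. sum F {2 * a + 1..<2 * a + 2 * Suc l}) \<le> (\<Sum>a<n. 1)"
    by (intro sum_mono le1) auto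
  moreover have "(\<Sum>a<n. sum F {2 * a + 1..<2 * a + 2 * Suc l}) =
      (\<Sum>a<n. F (2 * a + 1)) + (\<Sum>j<l. (\<Sum>a<n. F (2 * (a + Suc j) + 0)) +
        (\<Sum>a<n. F (2 * (a + Suc j) + 1)))"
    unfolding window sum.distrib sum.swap [of _ "{..<l}"] ..
  ultimately have "int (Suc l * card {j. j < n \<and> f (2 * j + 1) = i} +
      l * card {j. j < n \<and> f (2 * j + 0) = i}) \<le> int n"
    unfolding shift count by (simp add: algebra_simps)
  then show ?thesis
    unfolding of_nat_le_iff by simp
qed

text \<open>A linear programming argument: the weights \<open>\<alpha>\<close> and
  \<open>\<beta>\<close> are dual multipliers, summed over all classes, which together hold
  \<open>n\<close> edges and \<open>n\<close> vertices. As \<open>e\<close> and \<open>v\<close> are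
  integers, \<open>B\<close> may be smaller than the real optimum.\<close>

lemma num_colours_weight_bound:
  assumes n: "n \<ge> 3" and conn: "total_rainbow_connected (cycle_graph n) c"
    and few: "num_colours (cycle_graph n) c < n"
    and l: "n = 2 * l + 3 \<or> n = 2 * l + 4"
    and weight: "\<And>e v. Suc l * e + l * v \<le> n \<Longrightarrow> \<alpha> * e + \<beta> * v \<le> B"
  shows "(\<alpha> + \<beta>) * n \<le> B * num_colours (cycle_graph n) c"
proof -
  let ?f = "c \<circ> pos n"
  let ?C = "?f ` {..<2 * n}"
  let ?E = "\<lambda>i. {j. j < n \<and> ?f (Suc (2 * j)) = i}" and ?V = "\<lambda>i. {j. j < n \<and> ?f (2 * j) = i}"
  have arcs: "rainbow_arc ?f a (Suc l)" for a
  proof -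
    \<comment> \<open>The complementary arc would need \<open>2 * n - 2 * l - 3\<close> colours,
      which is \<open>n\<close> or \<open>n + 1\<close>.\<close>
    have "\<not> rainbow_arc ?f (a + Suc l) (n - Suc l)"
      using arc_length_le_num_colours [OF n, of c "a + Suc l" "n - Suc l"] few l by auto
    then show ?thesis
      using rainbow_arcs_if_total_rainbow_connected [OF n conn, of "Suc l" a] l by auto
  qed
  have "pos n (x + 2 * n) = pos n x" for x
    using n by (simp add: pos_eq_iff)
  then have periodic: "?f (x + 2 * n) = ?f x" for x
    by simp
  have card_C: "card ?C = num_colours (cycle_graph n) c"
    using n by (simp add: num_colours_cycle_graph)
  have partition: "(\<Sum>i\<in>?C. card {j. j < n \<and> h j = i}) = n" if "h ` {..<n} \<subseteq> ?C" for h
  proof -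
    have "(\<Sum>i\<in>?C. card {j \<in> {..<n}. h j = i}) = card (\<Union>i\<in>?C. {j \<in> {..<n}. h j = i})"
      by (intro card_UN_disjoint [symmetric]) auto
    also have "(\<Union>i\<in>?C. {j \<in> {..<n}. h j = i}) = {..<n}"
      using that by auto
    finally show ?thesis by simp
  qed
  have "(\<Sum>i\<in>?C. \<alpha> * card (?E i) + \<beta> * card (?V i)) \<le> (\<Sum>i\<in>?C. B)"
    using colour_class_bound [of ?f n l, OF periodic arcs] by (intro sum_mono weight)
  moreover have "(\<Sum>i\<in>?C. card (?E i)) = n"
    by (intro partition image_subsetI imageI) auto
  moreover have "(\<Sum>i\<in>?C. card (?V i)) = n"
    by (intro partition image_subsetI imageI) auto
  ultimately show ?thesis
    unfolding sum.distrib sum_distrib_left [symmetric] sum_constant card_C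
    by (simp add: algebra_simps)
qed

text \<open>With \<open>l = 2\<close>, integers with 3e + 2v \<le> 7 satisfy 2e + v \<le> 4, so 21
  \<le> 4m for m colours, and five are too few.\<close>

lemma num_colours_7:
  assumes "total_rainbow_connected (cycle_graph 7) c"
  shows "6 \<le> num_colours (cycle_graph 7) c"
proof (rule ccontr)
  assume "\<not> ?thesis"
  then show False
    using num_colours_weight_bound [OF _ assms, of 2 2 1 4] by simp
qed

text \<open>With \<open>l = 3\<close>, integers with 4e + 3v \<le> 9 satisfy 3e + 2v \<le> 6, so 45
  \<le> 6m for m colours, and seven are too few.\<close>

lemma num_colours_9:
  assumes "total_rainbow_connected (cycle_graph 9) c"
  shows "8 \<le> num_colours (cycle_graph 9) c"
proof (rule ccontr)
  assume "\<not> ?thesis"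
  then show False
    using num_colours_weight_bound [OF _ assms, of 3 3 2 6] by simp
qed

text \<open>Each element of a class contributes at least \<open>l\<close> to a total of at most
  \<open>n < 3 * l\<close>. So a class has at most two of the \<open>2 * n\<close> elements.\<close>

lemma num_colours_large:
  assumes "n = 11 \<or> n \<ge> 13" "total_rainbow_connected (cycle_graph n) c"
  shows "n \<le> num_colours (cycle_graph n) c"
proof (rule ccontr)
  assume few: "\<not> ?thesis"
  define l where "l = (n - 3) div 2"
  have l: "n = 2 * l + 3 \<or> n = 2 * l + 4"
    using assms(1) unfolding l_def by presburger
  \<comment> \<open>This fails for \<open>n = 12\<close>, where \<open>l = 4\<close> and the bound
    permits a class of three vertices.\<close>
  then have "3 * l > n" using assms(1) by presburger
  have "1 * e + 1 * v \<le> 2" if "Suc l * e + l * v \<le> n" for e v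
  proof (rule ccontr)
    assume "\<not> 1 * e + 1 * v \<le> 2"
    then have "l * 3 \<le> l * (e + v)" by (intro mult_le_mono) auto
    with that \<open>3 * l > n\<close> show False by (simp add: algebra_simps)
  qed
  then have "(1 + 1) * n \<le> 2 * num_colours (cycle_graph n) c"
    using assms few l by (intro num_colours_weight_bound) auto
  with few show False by simp
qed

section \<open>Combining the bounds\<close>

lemma strc_trc_eqI:
  assumes "\<exists>c. strongly_total_rainbow_connected G c \<and> num_colours G c = m"
    and "\<And>c. total_rainbow_connected G c \<Longrightarrow> m \<le> num_colours G c"
  shows "strc G = m \<and> trc G = m"
proof -
  \<comment> \<open>Hence one strong colouring bounds both parameters from above, and one lower
    bound for \<open>total_rainbow_connected\<close> serves both.\<close>
  have "total_rainbow_connected G c" if "strongly_total_rainbow_connected G c" for c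
    using that unfolding strongly_total_rainbow_connected_def total_rainbow_connected_def
      is_geodesic_def by blast
  with assms show ?thesis
    unfolding strc_def trc_def by (blast intro!: Least_equality)
qed

theorem theorem3p3:
  shows "(\<forall>n\<ge>3. strc (cycle_graph n) = trc (cycle_graph n)) \<and>
    strc (cycle_graph 3) = 1 \<and>
    strc (cycle_graph 4) = 3 \<and>
    strc (cycle_graph 5) = 3 \<and>
    strc (cycle_graph 6) = 5 \<and>
    strc (cycle_graph 7) = 6 \<and>
    strc (cycle_graph 8) = 7 \<and>
    strc (cycle_graph 9) = 8 \<and>
    strc (cycle_graph 10) = 9 \<and>
    strc (cycle_graph 11) = 11 \<and>
    strc (cycle_graph 12) = 11 \<and>
    (\<forall>n\<ge>13. strc (cycle_graph n) = n)"
proof -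
  \<comment> \<open>The last premise selects the lower bound: the general one where it is sharp, the
    weighted ones for 7 and 9.\<close>
  have small: "strc (cycle_graph n) = m \<and> trc (cycle_graph n) = m"
    if "strong_colour_list n xs" "n \<ge> 3" "length (remdups xs) = m"
      "m \<le> 2 * (n div 2) - 1 \<or> n = 7 \<and> m = 6 \<or> n = 9 \<and> m = 8" for n m xs
    using that by (intro strc_trc_eqI strong_colouring_of_list)
      (auto dest: num_colours_ge num_colours_7 num_colours_9)
  have large: "strc (cycle_graph n) = n \<and> trc (cycle_graph n) = n" if "n = 11 \<or> n \<ge> 13" for n
    using that by (intro strc_trc_eqI strong_colouring_trivial num_colours_large) auto
  have s3: "strc (cycle_graph 3) = 1 \<and> trc (cycle_graph 3) = 1"
    by (rule small [of _ "[0, 0, 0, 0, 0, 0]"], code_simp) simp_all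
  have s4: "strc (cycle_graph 4) = 3 \<and> trc (cycle_graph 4) = 3"
    by (rule small [of _ "[0, 0, 0, 0, 1, 2, 0, 1]"], code_simp) simp_all
  have s5: "strc (cycle_graph 5) = 3 \<and> trc (cycle_graph 5) = 3"
    by (rule small [of _ "[0, 1, 0, 2, 0, 1, 2, 0, 1, 2]"], code_simp) simp_all
  have s6: "strc (cycle_graph 6) = 5 \<and> trc (cycle_graph 6) = 5"
    by (rule small [of _ "[0, 1, 0, 2, 0, 1, 3, 4, 0, 2, 1, 3]"], code_simp) simp_all
  have s7: "strc (cycle_graph 7) = 6 \<and> trc (cycle_graph 7) = 6"
    by (rule small [of _ "[0, 1, 2, 3, 0, 4, 1, 2, 0, 3, 1, 4, 2, 5]"], code_simp) simp_all
  have s8: "strc (cycle_graph 8) = 7 \<and> trc (cycle_graph 8) = 7"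
    by (rule small [of _ "[0, 1, 2, 3, 0, 4, 1, 2, 5, 6, 0, 3, 1, 4, 2, 5]"], code_simp) simp_all
  have s9: "strc (cycle_graph 9) = 8 \<and> trc (cycle_graph 9) = 8"
    by (rule small [of _ "[0, 1, 2, 3, 4, 5, 0, 6, 1, 7, 4, 2, 0, 3, 5, 6, 4, 7]"], code_simp) simp_all
  have s10: "strc (cycle_graph 10) = 9 \<and> trc (cycle_graph 10) = 9"
    by (rule small [of _ "[0, 1, 2, 3, 4, 5, 0, 6, 1, 7, 8, 2, 0, 3, 1, 4, 5, 6, 7, 8]"], code_simp) simp_all
  have s12: "strc (cycle_graph 12) = 11 \<and> trc (cycle_graph 12) = 11"
    by (rule small [of _ "[0, 1, 2, 3, 4, 5, 6, 7, 0, 8, 2, 9, 10, 1, 3, 4, 0, 5, 2, 6, 7, 8, 9, 10]"], code_simp) simp_all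
  have "strc (cycle_graph n) = trc (cycle_graph n)" if "n \<ge> 3" for n
  proof (cases "n = 11 \<or> n \<ge> 13")
    case True
    then show ?thesis using large by simp
  next
    case False
    with that have "n = 3 \<or> n = 4 \<or> n = 5 \<or> n = 6 \<or> n = 7 \<or> n = 8 \<or> n = 9 \<or> n = 10 \<or> n = 12"
      by presburger
    then show ?thesis
      using s3 s4 s5 s6 s7 s8 s9 s10 s12 by auto
  qed
  then show ?thesis
    using s3 s4 s5 s6 s7 s8 s9 s10 s12 large by simp
qed

end
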